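(* Let $M\ge 1$ and let $h_1,\dots,h_M\in\mathbb{C}\setminus\{0\}$ be the channel gains of $M$ transmission nodes (TNs), labelled in an arbitrary order. Consider the following optimization problem: choose a nonempty set $A\subseteq\{1,\dots,M\}$ of active TNs (the TNs outside $A$ are idle) and transmission powers $P_m>0$ for $m\in A$ so as to minimize the total power consumption $$\sum_{m\in A}\big[\Psi(P_m)+\varepsilon\, r_{\rm dl}+P_{\rm base,tx}\big]+(M-|A|)\,P_{\rm idle}+\big[\varepsilon\, r_{\rm dl}+P_{\rm base,rx}\big]$$ subject to $R_{\rm dl}\le r_{\rm dl}$ and $0\le\Psi(P_m)\le P_{\max}$ for all $m\in A$, where $$r_{\rm dl}=W\log_2\Big[1+\frac{\big(\sum_{m\in A}\sqrt{P_m}\,|h_m|\big)^2}{I_{\rm out}+P_N}\Big],\qquad \Psi(P)=\frac{P+aP_{\max}}{(1+a)\eta_{\max}}.$$ Then for every optimal solution $\big(A,(P_m)_{m\in A}\big)$ of this problem, the active TNs have channel coefficients at least as good as those of the idle TNs: $$|h_i|\ge |h_j|\qquad\text{for all } i\in A \text{ and all } j\in\{1,\dots,M\}\setminus A,$$ that is, $\min\{|h_i|: i\in A\}\ge\max\{|h_j|: j\notin A\}$ (a vacuous condition if $A=\{1,\dots,M\}$).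
   Context: Setting: $M$ cooperative single-antenna transmission nodes jointly and coherently (with phase compensation) transmit the same symbol to one receiver, so the received amplitudes add up. $P_m$ is the transmission power of TN $m$; $P_m=0$ means that TN $m$ is idle, so an active TN has $P_m>0$. $r_{\rm dl}$ is the achieved data rate and $R_{\rm dl}>0$ is the required data rate. Energy efficiency is $R_{\rm dl}/P_{\rm total}$, so for fixed $R_{\rm dl}$ maximizing it is the same as minimizing the total power consumption. Constants (all real): bandwidth $W>0$; noise power $P_N>0$; out-of-cluster interference power $I_{\rm out}\ge 0$; dynamic circuit power coefficient $\varepsilon\ge 0$; static circuit powers $P_{\rm base,tx},P_{\rm base,rx}\ge 0$; idle power $P_{\rm idle}\ge 0$; parameter $a\ge 0$ of the envelope-tracking power amplifier (ETPA); maximum output power $P_{\max}>0$ and maximum amplifier efficiency $\eta_{\max}>0$. The amplifiers of all TNs are identical, i.e. $P_{\max}$ and $\eta_{\max}$ are common to all TNs. $\Psi(P)$ is the power drawn by the ETPA when its output transmission power is $P$. *)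

theory Defs
  imports Complex_Main
begin

definition etpa_power :: "real \<Rightarrow> real \<Rightarrow> real \<Rightarrow> real \<Rightarrow> real" where
  "etpa_power a P_max \<eta>_max P = (P + a * P_max) / ((1 + a) * \<eta>_max)"

text \<open>Coherent joint transmission: the received amplitudes of the active nodes add up
  before squaring.\<close>

definition dl_rate ::
    "real \<Rightarrow> real \<Rightarrow> real \<Rightarrow> (nat \<Rightarrow> complex) \<Rightarrow> nat set \<Rightarrow> (nat \<Rightarrow> real) \<Rightarrow> real" where
  "dl_rate W I_out P_N h A P =
     W * log 2 (1 + (\<Sum>m\<in>A. sqrt (P m) * cmod (h m))\<^sup>2 / (I_out + P_N))"

text \<open>A candidate solution is a pair of the set \<open>A\<close> of active nodes and a power
  allocation \<open>P\<close>. The values of \<open>P\<close> outside \<open>A\<close> carry no information: neither the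
  feasibility nor the cost of a candidate depends on them.\<close>

definition total_power ::
    "nat \<Rightarrow> (nat \<Rightarrow> complex) \<Rightarrow> real \<Rightarrow> real \<Rightarrow> real \<Rightarrow> real \<Rightarrow> real \<Rightarrow> real \<Rightarrow> real \<Rightarrow>
     real \<Rightarrow> real \<Rightarrow> real \<Rightarrow> nat set \<times> (nat \<Rightarrow> real) \<Rightarrow> real" where
  "total_power M h W P_N I_out \<epsilon> P_base_tx P_base_rx P_idle a P_max \<eta>_max = (\<lambda>(A, P).
     (\<Sum>m\<in>A. etpa_power a P_max \<eta>_max (P m) + \<epsilon> * dl_rate W I_out P_N h A P + P_base_tx)
     + (real M - real (card A)) * P_idle
     + (\<epsilon> * dl_rate W I_out P_N h A P + P_base_rx))"

definition feasible ::
    "nat \<Rightarrow> (nat \<Rightarrow> complex) \<Rightarrow> real \<Rightarrow> real \<Rightarrow> real \<Rightarrow> real \<Rightarrow> real \<Rightarrow> real \<Rightarrow> real \<Rightarrow>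
     nat set \<times> (nat \<Rightarrow> real) \<Rightarrow> bool" where
  "feasible M h W P_N I_out R_dl a P_max \<eta>_max = (\<lambda>(A, P).
     A \<noteq> {} \<and> A \<subseteq> {1..M} \<and> (\<forall>m\<in>A. P m > 0) \<and>
     R_dl \<le> dl_rate W I_out P_N h A P \<and>
     (\<forall>m\<in>A. 0 \<le> etpa_power a P_max \<eta>_max (P m) \<and> etpa_power a P_max \<eta>_max (P m) \<le> P_max))"

end

theory Submission imports Defs begin

text \<open>If an active node \<open>i\<close> had a weaker channel than an idle node \<open>j\<close>, exchanging their roles
  and giving \<open>j\<close> the power \<open>P i * |h i|\<^sup>2 / |h j|\<^sup>2 < P i\<close> would keep the received amplitude,
  hence the rate, and strictly lower the consumed power.\<close>

lemma etpa_power_strict_mono: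
  assumes "a \<ge> 0" and "\<eta>_max > 0" and "p < q"
  shows "etpa_power a P_max \<eta>_max p < etpa_power a P_max \<eta>_max q"
  using assms by (simp add: etpa_power_def divide_strict_right_mono)

text \<open>Both sums share the part over \<open>A - {i}\<close>. Agreement of \<open>g\<close> with
  \<open>f\<close> is demanded only there, so that \<open>g\<close> may come from an allocation
  altered at \<open>j\<close>. It serves for the amplitudes and for the amplifier powers.\<close>

lemma sum_exchange:
  fixes f g :: "'b \<Rightarrow> 'a::ab_group_add"
  assumes "finite A" and "i \<in> A" and "j \<notin> A"
    and "\<And>m. m \<in> A - {i} \<Longrightarrow> g m = f m"
  shows "sum g (insert j (A - {i})) = sum f A - f i + g j"
proof -
  have "sum g (A - {i}) = sum f (A - {i})"
    using assms(4) by (rule sum.cong[OF refl])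
  also have "\<dots> = sum f A - f i"
    using assms(1,2) by (simp add: sum_diff1)
  finally show ?thesis
    using assms(1,3) by (simp add: add.commute)
qed

theorem lemma1:
  fixes M :: nat and h :: "nat \<Rightarrow> complex"
    and W P_N I_out R_dl \<epsilon> P_base_tx P_base_rx P_idle a P_max \<eta>_max :: real
    and A :: "nat set" and P :: "nat \<Rightarrow> real"
  assumes "M \<ge> 1"
    and "\<And>m. m \<in> {1..M} \<Longrightarrow> h m \<noteq> 0"
    and "W > 0" and "P_N > 0" and "I_out \<ge> 0" and "R_dl > 0" and "\<epsilon> \<ge> 0"
    and "P_base_tx \<ge> 0" and "P_base_rx \<ge> 0" and "P_idle \<ge> 0"
    and "a \<ge> 0" and "P_max > 0" and "\<eta>_max > 0"
    and "is_arg_min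
           (total_power M h W P_N I_out \<epsilon> P_base_tx P_base_rx P_idle a P_max \<eta>_max)
           (feasible M h W P_N I_out R_dl a P_max \<eta>_max) (A, P)"
  shows "\<forall>i\<in>A. \<forall>j\<in>{1..M} - A. cmod (h i) \<ge> cmod (h j)"
proof (intro ballI, rule ccontr)
  fix i j
  assume i: "i \<in> A" and j: "j \<in> {1..M} - A" and "\<not> cmod (h i) \<ge> cmod (h j)"
  then have hij: "cmod (h i) < cmod (h j)"
    by simp
  have feas: "feasible M h W P_N I_out R_dl a P_max \<eta>_max (A, P)"
    and opt: "\<And>y. feasible M h W P_N I_out R_dl a P_max \<eta>_max y \<Longrightarrow>
      \<not> total_power M h W P_N I_out \<epsilon> P_base_tx P_base_rx P_idle a P_max \<eta>_max y
        < total_power M h W P_N I_out \<epsilon> P_base_tx P_base_rx P_idle a P_max \<eta>_max (A, P)"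
    using assms(14) unfolding is_arg_min_def by blast+
  from feas have AM: "A \<subseteq> {1..M}" and pos: "\<And>m. m \<in> A \<Longrightarrow> P m > 0"
    and rate: "R_dl \<le> dl_rate W I_out P_N h A P"
    and etpa: "\<And>m. m \<in> A \<Longrightarrow> 0 \<le> etpa_power a P_max \<eta>_max (P m)"
      "\<And>m. m \<in> A \<Longrightarrow> etpa_power a P_max \<eta>_max (P m) \<le> P_max"
    by (auto simp: feasible_def)
  have fin: "finite A"
    using AM finite_subset by blast
  \<comment> \<open>A nonzero gain at \<open>i\<close> keeps the new power of \<open>j\<close>
    strictly positive, as feasibility demands of an active node.\<close>
  have hi: "cmod (h i) > 0"
    using assms(2) AM i by auto
  define c where "c = cmod (h i) / cmod (h j)"
  have c: "0 < c" "c < 1"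
    using hi hij by (simp_all add: c_def divide_pos_pos order.strict_trans[OF hi hij]
        del: zero_less_norm_iff)
  define p where "p = P i * c\<^sup>2"
  have p: "0 < p" "p < P i"
    using c pos[OF i] by (auto simp: p_def power_less_one_iff)
  define B where "B = insert j (A - {i})"
  \<comment> \<open>The old value at \<open>i\<close> may stay, since \<open>i\<close> lies outside
    \<open>B\<close>.\<close>
  define Q where "Q = P(j := p)"
  have Q: "Q j = p" "\<And>m. m \<in> A - {i} \<Longrightarrow> Q m = P m"
    using j by (auto simp: Q_def)
  \<comment> \<open>With \<open>c\<close> still folded, \<open>c > 0\<close> turns the root of its
    square into \<open>c\<close>; unfolding it afterwards cancels \<open>cmod (h j)\<close>.\<close>
  have "sqrt p * cmod (h j) = sqrt (P i) * cmod (h i)"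
    using c hi hij by (simp add: p_def real_sqrt_mult) (auto simp: c_def)
  then have amplitude: "(\<Sum>m\<in>B. sqrt (Q m) * cmod (h m)) = (\<Sum>m\<in>A. sqrt (P m) * cmod (h m))"
    unfolding B_def
    by (subst sum_exchange[where f = "\<lambda>m. sqrt (P m) * cmod (h m)"]) (use fin i j Q in auto)
  \<comment> \<open>The rate depends on the candidate only through the amplitude sum.\<close>
  then have rate_eq: "dl_rate W I_out P_N h B Q = dl_rate W I_out P_N h A P"
    by (simp add: dl_rate_def)
  have less: "etpa_power a P_max \<eta>_max p < etpa_power a P_max \<eta>_max (P i)"
    using assms p by (intro etpa_power_strict_mono)
  \<comment> \<open>The upper bound \<open>P_max\<close> for the new node is inherited from
    \<open>i\<close> through \<open>less\<close>; only the lower bound needs its own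
    argument.\<close>
  have "0 \<le> etpa_power a P_max \<eta>_max p"
    using assms p by (simp add: etpa_power_def)
  then have "feasible M h W P_N I_out R_dl a P_max \<eta>_max (B, Q)"
    using AM j pos rate etpa p Q less etpa(2)[OF i] rate_eq
    by (auto simp: feasible_def B_def)
  moreover have "total_power M h W P_N I_out \<epsilon> P_base_tx P_base_rx P_idle a P_max \<eta>_max (B, Q)
      < total_power M h W P_N I_out \<epsilon> P_base_tx P_base_rx P_idle a P_max \<eta>_max (A, P)"
  proof -
    \<comment> \<open>Equal cardinalities and equal rates make all circuit and idle terms agree, so
      the costs differ only in the amplifier sums.\<close>
    have "card B = card A"
      using fin i j card_Suc_Diff1[of A i] by (simp add: B_def)
    moreover have "(\<Sum>m\<in>B. etpa_power a P_max \<eta>_max (Q m))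
        = (\<Sum>m\<in>A. etpa_power a P_max \<eta>_max (P m))
          - etpa_power a P_max \<eta>_max (P i) + etpa_power a P_max \<eta>_max p"
      unfolding B_def
      by (subst sum_exchange[where f = "\<lambda>m. etpa_power a P_max \<eta>_max (P m)"])
        (use fin i j Q in auto)
    ultimately show ?thesis
      using less by (simp add: total_power_def rate_eq sum.distrib)
  qed
  ultimately show False
    using opt by blast
qed

end
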